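(* Let $c,r\in[0,\infty)$ and suppose the move costs are $w_{n,k}=\alpha_n=cr^n$ for all $n\in\mathbb{N}_0$ and all $k\in T=\{0,1,2\}$. Let $t_n$ denote the common value $d_{n,0}=d_{n,1}=d_{n,2}$ of the minimal costs. Then for all $n\in\mathbb{N}_0$, $$t_n=c\,2^{n-1}\sum_{\nu=0}^{n-1}\Bigl(\frac r2\Bigr)^\nu=\begin{cases}c\,2^{n-1}\,\dfrac{1-(r/2)^n}{1-r/2}=c\,\dfrac{2^n-r^n}{2-r},&\text{if }r\ne2,\\[2mm] c\,2^{n-1}\,n,&\text{if }r=2.\end{cases}$$
   Context: Convention: $0^0=1$; an empty sum is zero. Weighted Tower of Hanoi: $\mathbb{N}_0$ denotes the nonnegative integers; $T=\{0,1,2\}$ is the set of pegs; discs are labelled $1,2,3,\dots$ by increasing size. A state with $n$ discs is an assignment of the discs $1,\dots,n$ to the pegs, the discs on each peg being stacked with smaller discs above larger ones. A legal move transfers the topmost (smallest) disc of one peg to a different peg carrying no smaller disc. For $i\in T$, $i^n$ is the perfect state with all $n$ discs on peg $i$. For $\{i,j,k\}=T$ and $n\in\mathbb{N}_0$, $w_{n,k}\in[0,\infty)$ is a given cost of a single move of disc $n+1$ between pegs $i$ and $j$ (in either direction), and $d_{n,k}$ is the minimal total cost, over all finite sequences of legal moves, of getting from $i^n$ to $j^n$ with $n$ discs. When the costs do not depend on $k$, the values $d_{n,0},d_{n,1},d_{n,2}$ coincide. *)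

theory Defs
  imports Complex_Main "HOL-Library.FuncSet"
begin

definition pegs :: "nat set" where
  "pegs = {0, 1, 2}"

text \<open>
  A state only records the peg of each disc: the order of the discs on a peg is forced.
  States are extensional functions, so that equality of functions is equality of states.
\<close>

definition hanoi_states :: "nat \<Rightarrow> (nat \<Rightarrow> nat) set" where
  "hanoi_states n = {1..n} \<rightarrow>\<^sub>E pegs"

definition perfect_state :: "nat \<Rightarrow> nat \<Rightarrow> nat \<Rightarrow> nat" where
  "perfect_state n i = (\<lambda>e\<in>{1..n}. i)"

text \<open>
  \<open>legal_move n s e j s'\<close>: with \<open>n\<close> discs, moving disc \<open>e\<close> from its peg \<open>s e\<close> to peg \<open>j\<close>
  is legal in state \<open>s\<close> and leads to \<open>s'\<close>. Disc \<open>e\<close> is the topmost one of its peg iff no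
  smaller disc lies on that peg.
\<close>

definition legal_move ::
    "nat \<Rightarrow> (nat \<Rightarrow> nat) \<Rightarrow> nat \<Rightarrow> nat \<Rightarrow> (nat \<Rightarrow> nat) \<Rightarrow> bool" where
  "legal_move n s e j s' \<longleftrightarrow>
     s \<in> hanoi_states n \<and> e \<in> {1..n} \<and> j \<in> pegs \<and> j \<noteq> s e \<and>
     (\<forall>f\<in>{1..n}. f < e \<longrightarrow> s f \<noteq> s e) \<and>
     (\<forall>f\<in>{1..n}. f < e \<longrightarrow> s f \<noteq> j) \<and>
     s' = s(e := j)"

text \<open>
  \<open>move_sequence w n s C t\<close>: some finite sequence of legal moves with \<open>n\<close> discs leads from
  \<open>s\<close> to \<open>t\<close> and has total cost \<open>C\<close>. The cost \<open>w m k\<close> is that of a move of disc \<open>m + 1\<close>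
  between the two pegs other than \<open>k\<close>; so disc \<open>e\<close> is charged with index \<open>e - 1\<close>, where
  \<open>e \<ge> 1\<close> by legality.
\<close>

inductive move_sequence ::
    "(nat \<Rightarrow> nat \<Rightarrow> real) \<Rightarrow> nat \<Rightarrow> (nat \<Rightarrow> nat) \<Rightarrow> real \<Rightarrow> (nat \<Rightarrow> nat) \<Rightarrow> bool"
  for w :: "nat \<Rightarrow> nat \<Rightarrow> real" and n :: nat where
  empty: "s \<in> hanoi_states n \<Longrightarrow> move_sequence w n s 0 s"
| step: "legal_move n s e j s' \<Longrightarrow> {s e, j, k} = pegs \<Longrightarrow> move_sequence w n s' C t
    \<Longrightarrow> move_sequence w n s (w (e - 1) k + C) t"

definition is_min_cost :: "(nat \<Rightarrow> nat \<Rightarrow> real) \<Rightarrow> nat \<Rightarrow> nat \<Rightarrow> nat \<Rightarrow> real \<Rightarrow> bool" where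
  "is_min_cost w n i j C \<longleftrightarrow>
     move_sequence w n (perfect_state n i) C (perfect_state n j) \<and>
     (\<forall>C'. move_sequence w n (perfect_state n i) C' (perfect_state n j) \<longrightarrow> C \<le> C')"

text \<open>
  The minimal cost between the two pegs other than \<open>k\<close>. For nonnegative \<open>w\<close> the minimum
  is attained and, moves being reversible at the same cost, is the same in both directions.
\<close>

definition min_cost :: "(nat \<Rightarrow> nat \<Rightarrow> real) \<Rightarrow> nat \<Rightarrow> nat \<Rightarrow> real" where
  "min_cost w n k = (THE C. \<forall>i j. {i, j, k} = pegs \<longrightarrow> is_min_cost w n i j C)"

end

theory Submission
  imports Defs
begin

text \<open>
  When the costs do not depend on the pegs, the minimal cost satisfies the classical recursion
  \<open>t (n + 1) = 2 * t n + \<alpha> n\<close> with \<open>t 0 = 0\<close>: carry the smaller tower to the spare peg, move the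
  largest disc once, carry the smaller tower on top of it. Executing this recipe shows that
  \<open>t n\<close> is attained (\<open>move_sequence_hanoi_cost\<close>).

  For optimality the recipe is extended to arbitrary initial states: if the largest disc is already
  on the target peg \<open>j\<close>, only the smaller discs have to be gathered on \<open>j\<close>; otherwise they are
  gathered on the spare peg, the largest disc is moved, and a whole tower is carried over. The
  cost of this strategy is a function \<open>gather_cost\<close> of the state, which serves as a potential: a
  single legal move lowers it by at most the cost of that move (\<open>gather_cost_step\<close>). As it is zero at
  the target and \<open>t n\<close> at the other two perfect states, no sequence of moves is cheaper than
  \<open>t n\<close>. This argument avoids cutting a sequence of moves at the first and last move of the
  largest disc.

  All of this holds for every nonnegative \<open>\<alpha>\<close>; the geometric costs enter only when the
  recursion is solved.
\<close>

section \<open>The cost of the recursive strategy\<close>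

fun hanoi_cost :: "(nat \<Rightarrow> real) \<Rightarrow> nat \<Rightarrow> real" where
  "hanoi_cost a 0 = 0"
| "hanoi_cost a (Suc n) = 2 * hanoi_cost a n + a n"

lemma hanoi_cost_nonneg:
  assumes "\<And>m. 0 \<le> a m"
  shows "0 \<le> hanoi_cost a n"
  using assms by (induction n) auto

lemma hanoi_cost_geometric:
  "hanoi_cost (\<lambda>m. c * r ^ m) n = c * 2 powi (int n - 1) * (\<Sum>\<nu><n. (r / 2) ^ \<nu>)"
proof (induction n)
  case 0
  show ?case by simp
next
  case (Suc n)
  have "(2::real) powi (int n - 1) = 2 ^ n / 2"
    by (simp add: power_int_diff)
  with Suc show ?case
    by (simp add: power_divide field_simps)
qed

text \<open>
  The pegs are numbered \<open>0, 1, 2\<close>, so the one distinct from two given pegs is found by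
  subtracting these from \<open>3\<close>.
\<close>

definition third_peg :: "nat \<Rightarrow> nat \<Rightarrow> nat" where
  "third_peg i j = 3 - i - j"

lemma third_peg:
  assumes "i \<in> pegs" "j \<in> pegs" "i \<noteq> j"
  shows "third_peg i j \<in> pegs" "third_peg i j \<noteq> i" "third_peg i j \<noteq> j"
    "{i, j, third_peg i j} = pegs"
  using assms by (auto simp: pegs_def third_peg_def)

lemma third_peg_unique:
  assumes "i \<in> pegs" "j \<in> pegs" "i \<noteq> j" "p \<in> pegs" "p \<noteq> i" "p \<noteq> j"
  shows "third_peg i j = p"
  using assms by (auto simp: pegs_def third_peg_def)

section \<open>The strategy is executable\<close>

lemma move_sequence_trans:
  assumes "move_sequence w n s C t" "move_sequence w n t C' u"
  shows "move_sequence w n s (C + C') u"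
  using assms
proof (induction rule: move_sequence.induct)
  case (step s e j s' k C t)
  then show ?case
    using move_sequence.step by (metis add.assoc)
qed simp

lemma perfect_state_in_hanoi_states: "i \<in> pegs \<Longrightarrow> perfect_state n i \<in> hanoi_states n"
  by (auto simp: perfect_state_def hanoi_states_def)

lemma hanoi_states_Suc_upd:
  "s \<in> hanoi_states n \<Longrightarrow> p \<in> pegs \<Longrightarrow> s(Suc n := p) \<in> hanoi_states (Suc n)"
  by (fastforce simp: hanoi_states_def PiE_iff extensional_def)

lemma perfect_state_Suc: "perfect_state (Suc n) i = (perfect_state n i)(Suc n := i)"
  by (auto simp: perfect_state_def fun_eq_iff)

text \<open>A larger disc at the bottom of some peg does not obstruct the smaller ones.\<close>

lemma move_sequence_add_disc:
  assumes "move_sequence w n s C t" "p \<in> pegs"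
  shows "move_sequence w (Suc n) (s(Suc n := p)) C (t(Suc n := p))"
  using assms
proof (induction rule: move_sequence.induct)
  case (empty s)
  then show ?case
    by (intro move_sequence.empty hanoi_states_Suc_upd)
next
  case (step s e j s' k C t)
  have "legal_move (Suc n) (s(Suc n := p)) e j (s'(Suc n := p))"
    using step.hyps(1) hanoi_states_Suc_upd[of s n p] step.prems
    unfolding legal_move_def by (auto simp: fun_upd_twist)
  moreover have "{(s(Suc n := p)) e, j, k} = pegs"
    using step.hyps(1,2) by (auto simp: legal_move_def)
  ultimately show ?case
    using step by (intro move_sequence.step)
qed

lemma move_sequence_hanoi_cost:
  assumes w: "\<And>m l. l \<in> pegs \<Longrightarrow> w m l = a m"
    and "i \<in> pegs" "j \<in> pegs" "i \<noteq> j"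
  shows "move_sequence w n (perfect_state n i) (hanoi_cost a n) (perfect_state n j)"
  using assms(2-)
proof (induction n arbitrary: i j)
  case 0
  have "perfect_state 0 i = perfect_state 0 j"
    by (simp add: perfect_state_def fun_eq_iff)
  then show ?case
    using 0 by (simp add: move_sequence.empty perfect_state_in_hanoi_states)
next
  case (Suc n)
  define k where "k = third_peg i j"
  note k = third_peg[OF Suc.prems, folded k_def]
  define s where "s = (perfect_state n k)(Suc n := i)"
  define s' where "s' = (perfect_state n k)(Suc n := j)"
  have gather: "move_sequence w (Suc n) (perfect_state (Suc n) i) (hanoi_cost a n) s"
    unfolding s_def perfect_state_Suc
    by (intro move_sequence_add_disc Suc.IH) (use Suc.prems k in auto)
  have carry: "move_sequence w (Suc n) s' (hanoi_cost a n) (perfect_state (Suc n) j)"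
    unfolding s'_def perfect_state_Suc
    by (intro move_sequence_add_disc Suc.IH) (use Suc.prems k in auto)
  have s: "s \<in> hanoi_states (Suc n)"
    unfolding s_def
    by (intro hanoi_states_Suc_upd perfect_state_in_hanoi_states Suc.prems k)
  have "legal_move (Suc n) s (Suc n) j s'"
    using s Suc.prems k unfolding legal_move_def
    by (auto simp: s_def s'_def perfect_state_def)
  moreover have "{s (Suc n), j, k} = pegs"
    using k by (simp add: s_def)
  ultimately have "move_sequence w (Suc n) s (w (Suc n - 1) k + hanoi_cost a n)
      (perfect_state (Suc n) j)"
    using carry by (rule move_sequence.step)
  from move_sequence_trans[OF gather this] show ?case
    using w[OF k(1)] by (simp add: algebra_simps)
qed

section \<open>No sequence of moves is cheaper\<close>

fun gather_cost :: "(nat \<Rightarrow> real) \<Rightarrow> nat \<Rightarrow> (nat \<Rightarrow> nat) \<Rightarrow> nat \<Rightarrow> real" where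
  "gather_cost a 0 s j = 0"
| "gather_cost a (Suc n) s j =
    (if s (Suc n) = j then gather_cost a n s j
     else gather_cost a n s (third_peg (s (Suc n)) j) + a n + hanoi_cost a n)"

lemma gather_cost_perfect:
  assumes "\<And>f. f \<in> {1..n} \<Longrightarrow> s f = i" "i \<in> pegs" "j \<in> pegs"
  shows "gather_cost a n s j = (if i = j then 0 else hanoi_cost a n)"
  using assms
proof (induction n arbitrary: j)
  case 0
  show ?case by simp
next
  case (Suc n)
  have IH: "gather_cost a n s l = (if i = l then 0 else hanoi_cost a n)" if "l \<in> pegs" for l
    using Suc that by simp
  have "s (Suc n) = i"
    using Suc.prems by simp
  then show ?case
    using IH[of j] IH[of "third_peg i j"] third_peg[of i j] Suc.prems by auto
qed

text \<open>
  A move of a disc other than the largest leaves the choice made for the largest disc unchanged,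
  so the claim is inherited from the smaller tower. When the largest disc moves, the smaller ones
  form a tower on the peg not involved in the move, so that both potentials are known
  explicitly by \<open>gather_cost_perfect\<close>.

  The delicate case is that of the largest disc moving between the two pegs other than the target:
  the potential does not change at all, and the cost of the move is paid for nothing.
\<close>

lemma gather_cost_step:
  assumes a: "\<And>m. 0 \<le> a m"
    and "\<And>f. f \<in> {1..n} \<Longrightarrow> s f \<in> pegs"
    and "e \<in> {1..n}" "i \<in> pegs" "i \<noteq> s e" "j \<in> pegs"
    and "\<And>f. f \<in> {1..n} \<Longrightarrow> f < e \<Longrightarrow> s f \<noteq> s e \<and> s f \<noteq> i"
  shows "gather_cost a n s j \<le> a (e - 1) + gather_cost a n (s(e := i)) j"
  using assms(2-)
proof (induction n arbitrary: j)
  case 0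
  then show ?case by simp
next
  case (Suc n)
  define s' where "s' = s(e := i)"
  have "gather_cost a (Suc n) s j \<le> a (e - 1) + gather_cost a (Suc n) s' j"
  proof (cases "e = Suc n")
    case False
    have IH: "gather_cost a n s l \<le> a (e - 1) + gather_cost a n s' l" if "l \<in> pegs" for l
      unfolding s'_def by (rule Suc.IH) (use False Suc.prems that in auto)
    have "s (Suc n) \<in> pegs"
      using Suc.prems by simp
    moreover have "s' (Suc n) = s (Suc n)"
      using False by (simp add: s'_def)
    ultimately show ?thesis
      using IH[of j] IH[of "third_peg (s (Suc n)) j"] third_peg(1)[of "s (Suc n)" j]
        Suc.prems(5) by auto
  next
    case True
    define q where "q = s (Suc n)"
    have q: "q \<in> pegs" "q \<noteq> i"
      using Suc.prems True by (auto simp: q_def)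
    define p where "p = third_peg q i"
    note p = third_peg[OF q(1) Suc.prems(3) q(2), folded p_def]
    have tower: "s f = p" if "f \<in> {1..n}" for f
      unfolding p_def
      by (rule third_peg_unique[symmetric])
        (use that q Suc.prems(1,3) Suc.prems(6)[of f] True in \<open>auto simp: q_def\<close>)
    have pot: "gather_cost a n s l = (if p = l then 0 else hanoi_cost a n)"
      "gather_cost a n s' l = (if p = l then 0 else hanoi_cost a n)"
      if "l \<in> pegs" for l
      by (rule gather_cost_perfect; use tower p that True in \<open>simp add: s'_def\<close>)+
    have s': "s' (Suc n) = i"
      using True by (simp add: s'_def)
    have t: "0 \<le> hanoi_cost a n" "0 \<le> a n"
      using a hanoi_cost_nonneg by auto
    consider "j = q" | "j = i" | "j = p"
      using p(4) Suc.prems(5) by auto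
    then show ?thesis
    proof cases
      case 1
      have "third_peg i q \<in> pegs"
        using third_peg(1) q Suc.prems(3) by metis
      then show ?thesis
        using 1 t s' q p(1-3) True pot(1)[of q] pot(2)[of "third_peg i q"]
        by (simp add: q_def[symmetric])
    next
      case 2
      then show ?thesis
        using t s' q p(1-3) Suc.prems(3) True pot(1)[of p] pot(2)[of i]
        by (simp add: q_def[symmetric] p_def[symmetric])
    next
      case 3
      \<comment> \<open>The smaller discs sit on the target peg, from which the strategy removes them in both states.\<close>
      have "third_peg q p = i" "third_peg i p = q"
        using third_peg_unique p(1-3) q Suc.prems(3) by metis+
      then show ?thesis
        using 3 t s' q p(1-3) Suc.prems(3) True pot(1)[of i] pot(2)[of q]
        by (simp add: q_def[symmetric])
    qed
  qed
  then show ?case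
    unfolding s'_def .
qed

lemma gather_cost_le_move_sequence:
  assumes w: "\<And>m l. l \<in> pegs \<Longrightarrow> w m l = a m" and a: "\<And>m. 0 \<le> a m"
    and "move_sequence w n s C t" "j \<in> pegs"
  shows "gather_cost a n s j \<le> C + gather_cost a n t j"
  using assms(3-)
proof (induction rule: move_sequence.induct)
  case (empty s)
  show ?case by simp
next
  case (step s e i s' k C t)
  have s': "s' = s(e := i)" and k: "k \<in> pegs"
    using step.hyps(1,2) by (auto simp: legal_move_def)
  have "gather_cost a n s j \<le> a (e - 1) + gather_cost a n s' j"
    unfolding s' using step.hyps(1) step.prems
    by (intro gather_cost_step a) (auto simp: legal_move_def hanoi_states_def PiE_iff)
  then show ?case
    using step.IH[OF step.prems] w[OF k] by simp
qed

lemma hanoi_cost_le_move_sequence: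
  assumes w: "\<And>m l. l \<in> pegs \<Longrightarrow> w m l = a m" and a: "\<And>m. 0 \<le> a m"
    and ij: "i \<in> pegs" "j \<in> pegs" "i \<noteq> j"
    and seq: "move_sequence w n (perfect_state n i) C (perfect_state n j)"
  shows "hanoi_cost a n \<le> C"
proof -
  have "gather_cost a n (perfect_state n i) j = hanoi_cost a n"
    by (subst gather_cost_perfect[where i = i]) (use ij in \<open>auto simp: perfect_state_def\<close>)
  moreover have "gather_cost a n (perfect_state n j) j = 0"
    by (subst gather_cost_perfect[where i = j]) (use ij in \<open>auto simp: perfect_state_def\<close>)
  ultimately show ?thesis
    using gather_cost_le_move_sequence[OF w a seq ij(2)] by simp
qed

section \<open>The minimal cost\<close>

lemma is_min_cost_unique: "is_min_cost w n i j C \<Longrightarrow> is_min_cost w n i j C' \<Longrightarrow> C = C'"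
  unfolding is_min_cost_def by (meson order_antisym)

lemma min_cost_eq_hanoi_cost:
  assumes w: "\<And>m l. l \<in> pegs \<Longrightarrow> w m l = a m" and a: "\<And>m. 0 \<le> a m"
    and k: "k \<in> pegs"
  shows "min_cost w n k = hanoi_cost a n"
proof -
  have min: "is_min_cost w n i j (hanoi_cost a n)" if "{i, j, k} = pegs" for i j
  proof -
    have "card {i, j, k} = 3"
      using that by (simp add: pegs_def)
    then have "i \<noteq> j"
      by (auto simp: card_insert_if split: if_splits)
    with that have ij: "i \<in> pegs" "j \<in> pegs" "i \<noteq> j"
      by auto
    have "move_sequence w n (perfect_state n i) (hanoi_cost a n) (perfect_state n j)"
      by (rule move_sequence_hanoi_cost; fact w ij)
    moreover have "hanoi_cost a n \<le> C"
      if "move_sequence w n (perfect_state n i) C (perfect_state n j)" for C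
      by (rule hanoi_cost_le_move_sequence; fact w a ij that)
    ultimately show ?thesis
      unfolding is_min_cost_def by blast
  qed
  \<comment> \<open>Some pair of pegs completes \<open>k\<close>, so the defining condition of \<open>min_cost\<close> is not vacuous and
    determines the value.\<close>
  obtain i j where ij: "{i, j, k} = pegs"
  proof -
    have "{1, 2, 0} = pegs" "{0, 2, 1} = pegs" "{0, 1, 2} = pegs"
      by (auto simp: pegs_def)
    then show ?thesis
      using k that by (auto simp: pegs_def)
  qed
  show ?thesis
    unfolding min_cost_def
  proof (rule the_equality)
    fix C
    assume "\<forall>i j. {i, j, k} = pegs \<longrightarrow> is_min_cost w n i j C"
    then have "is_min_cost w n i j C"
      using ij by simp
    then show "C = hanoi_cost a n"
      using min[OF ij] by (rule is_min_cost_unique)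
  qed (simp add: min)
qed

theorem proposition3:
  fixes c r :: real and w :: "nat \<Rightarrow> nat \<Rightarrow> real" and n k :: nat
  assumes "0 \<le> c" and "0 \<le> r"
    and "\<And>m l. l \<in> pegs \<Longrightarrow> w m l = c * r ^ m"
    and "k \<in> pegs"
  shows "min_cost w n k = c * 2 powi (int n - 1) * (\<Sum>\<nu><n. (r / 2) ^ \<nu>)
    \<and> (r \<noteq> 2 \<longrightarrow>
         min_cost w n k = c * 2 powi (int n - 1) * ((1 - (r / 2) ^ n) / (1 - r / 2))
       \<and> min_cost w n k = c * ((2 ^ n - r ^ n) / (2 - r)))
    \<and> (r = 2 \<longrightarrow> min_cost w n k = c * 2 powi (int n - 1) * real n)"
proof -
  have "min_cost w n k = hanoi_cost (\<lambda>m. c * r ^ m) n"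
    by (rule min_cost_eq_hanoi_cost) (use assms in auto)
  then have sum: "min_cost w n k = c * 2 powi (int n - 1) * (\<Sum>\<nu><n. (r / 2) ^ \<nu>)"
    by (simp add: hanoi_cost_geometric)
  have geom: "(\<Sum>\<nu><n. (r / 2) ^ \<nu>) = (1 - (r / 2) ^ n) / (1 - r / 2)" if "r \<noteq> 2"
    using that by (simp add: sum_gp_strict)
  \<comment> \<open>For \<open>r = 2\<close> this holds too, both sides being divisions by zero.\<close>
  have closed: "2 powi (int n - 1) * ((1 - (r / 2) ^ n) / (1 - r / 2)) = (2 ^ n - r ^ n) / (2 - r)"
  proof -
    have "(2::real) powi (int n - 1) = 2 ^ n / 2"
      by (simp add: power_int_diff)
    then have "2 powi (int n - 1) * ((1 - (r / 2) ^ n) / (1 - r / 2))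
        = (2 ^ n * (1 - (r / 2) ^ n)) / (2 * (1 - r / 2))"
      by (simp only: times_divide_times_eq)
    also have "2 ^ n * (1 - (r / 2) ^ n) = 2 ^ n - r ^ n"
      by (simp add: power_divide right_diff_distrib)
    also have "2 * (1 - r / 2) = 2 - r"
      by simp
    finally show ?thesis .
  qed
  show ?thesis
  proof (intro conjI impI)
    assume "r \<noteq> 2"
    with sum geom show "min_cost w n k =
        c * 2 powi (int n - 1) * ((1 - (r / 2) ^ n) / (1 - r / 2))"
      by metis
    then show "min_cost w n k = c * ((2 ^ n - r ^ n) / (2 - r))"
      unfolding mult.assoc closed .
  qed (use sum in auto)
qed

end
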